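(* Let $\mu$ be a diffuse (atomless) probability measure on $(\mathbb R,\mathcal B(\mathbb R))$ with distribution function $F$. Let $(\alpha_k)_{k\ge1}$ be a sequence in $]0,1[$, let $(r_k)_{k}$ be the associated generalized Rademacher sequence, and let $(\widetilde r_k)_k$ be the classical Rademacher sequence. Then $(r_k\circ F)_k$ and $(\widetilde r_k\circ F)_k$ are each a sequence of independent random variables on $(\mathbb R,\mathcal B(\mathbb R),\mu)$.
   Context: Classical Rademacher sequence on $[0,1]$: $\widetilde r_0=1$ and $\widetilde r_k=\sum_{j=0}^{2^k-1}(-1)^j1_{]j/2^k,(j+1)/2^k]}$ for $k\ge1$. Generalized Rademacher sequence: put $a_0^0=0$, $a_1^0=1$, and for $k\ge0$ and $0\le j\le 2^k-1$ define recursively $a_{2j}^{k+1}=a_j^k$, $a_{2j+1}^{k+1}=a_j^k+\alpha_{k+1}(a_{j+1}^k-a_j^k)$, and $a_{2^{k+1}}^{k+1}=1$. Then $r_0=1$ and, for $k\ge1$, $r_k=\sum_{j=0}^{2^k-1}(-1)^j\,1_{]a_j^k,a_{j+1}^k]}$. A sequence of random variables is called independent if for all indices $k_1<\dots<k_N$ the variables with these indices are mutually independent. *)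

theory Defs
  imports "HOL-Probability.Probability"
begin

text \<open>On the real line, having no atoms is the same as giving no mass to points.\<close>

definition diffuse :: "real measure \<Rightarrow> bool" where
  "diffuse M \<longleftrightarrow> (\<forall>x. emeasure M {x} = 0)"

text \<open>
  Both Rademacher sequences are functions on \<open>[0,1]\<close>, totalized by reading their defining
  formulas on all of \<^typ>\<open>real\<close>; a distribution function only takes values in \<open>[0,1]\<close>.
\<close>

definition rademacher :: "nat \<Rightarrow> real \<Rightarrow> real" where
  "rademacher k x =
     (if k = 0 then 1
      else \<Sum>j = 0..2 ^ k - 1. (-1) ^ j * indicator {real j / 2 ^ k <.. real (j + 1) / 2 ^ k} x)"

text \<open>
  \<open>rademacher_node \<alpha> k j\<close> is the division point \<open>a\<^sub>j\<close> of level \<open>k\<close>. It is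
  meaningful only for \<open>j \<le> 2 ^ k\<close>; \<open>\<alpha> 0\<close> is never used.
\<close>

primrec rademacher_node :: "(nat \<Rightarrow> real) \<Rightarrow> nat \<Rightarrow> nat \<Rightarrow> real" where
  "rademacher_node \<alpha> 0 j = (if j = 0 then 0 else 1)"
| "rademacher_node \<alpha> (Suc k) j =
     (if j = 2 ^ Suc k then 1
      else if even j then rademacher_node \<alpha> k (j div 2)
      else rademacher_node \<alpha> k (j div 2)
           + \<alpha> (Suc k) * (rademacher_node \<alpha> k (j div 2 + 1) - rademacher_node \<alpha> k (j div 2)))"

definition gen_rademacher :: "(nat \<Rightarrow> real) \<Rightarrow> nat \<Rightarrow> real \<Rightarrow> real" where
  "gen_rademacher \<alpha> k x =
     (if k = 0 then 1
      else \<Sum>j = 0..2 ^ k - 1.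
             (-1) ^ j * indicator {rademacher_node \<alpha> k j <.. rademacher_node \<alpha> k (j + 1)} x)"

end

theory Submission
  imports Defs
begin

text \<open>
  As \<open>\<mu>\<close> has no atoms, \<open>F\<close> is uniformly distributed on \<open>[0,1]\<close> under \<open>\<mu>\<close>. The \<open>k\<close>-th generalized
  Rademacher function is \<open>1\<close> on the left part (of relative length \<open>\<alpha> k\<close>) and \<open>-1\<close> on the right part
  of every cell of level \<open>k - 1\<close>. So, conditionally on a cell of level \<open>n\<close>, the functions
  of the levels \<open>n + 1, \<dots>, n + m\<close> have a product law that does not depend on the cell,
  by induction on \<open>m\<close>. The classical sequence is the case \<open>\<alpha> = 1/2\<close>.
\<close>

section \<open>Division points\<close>

lemma rademacher_node_0: "rademacher_node \<alpha> k 0 = 0"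
  by (induction k) auto

lemma rademacher_node_top: "rademacher_node \<alpha> k (2 ^ k) = 1"
  by (cases k) auto

text \<open>At \<open>j = 2 ^ k\<close> the boundary clause of the recursion fires, and both sides
  are 1.\<close>

lemma rademacher_node_even:
  assumes "j \<le> 2 ^ k"
  shows "rademacher_node \<alpha> (Suc k) (2 * j) = rademacher_node \<alpha> k j"
  using assms by (auto simp: rademacher_node_top)

lemma rademacher_node_odd:
  "rademacher_node \<alpha> (Suc k) (Suc (2 * j)) = rademacher_node \<alpha> k j
     + \<alpha> (Suc k) * (rademacher_node \<alpha> k (Suc j) - rademacher_node \<alpha> k j)"
proof -
  \<comment> \<open>An odd number is no power of two with positive exponent, so the boundary clause
    cannot fire.\<close>
  have "Suc (2 * j) \<noteq> 2 ^ Suc k"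
    by (metis even_Suc even_mult_iff even_numeral power_Suc)
  then show ?thesis
    by simp
qed

declare rademacher_node.simps(2) [simp del]

text \<open>Each inserted point is a convex combination of the ends of its parent cell.\<close>

lemma rademacher_node_le_Suc:
  assumes \<alpha>: "\<And>k. k \<ge> 1 \<Longrightarrow> 0 \<le> \<alpha> k \<and> \<alpha> k \<le> 1"
  shows "j < 2 ^ k \<Longrightarrow> rademacher_node \<alpha> k j \<le> rademacher_node \<alpha> k (Suc j)"
proof (induction k arbitrary: j)
  case 0
  then show ?case by simp
next
  case (Suc k)
  define i where "i = j div 2"
  have i: "i < 2 ^ k"
    using Suc.prems unfolding i_def by auto
  let ?a = "rademacher_node \<alpha> k i" and ?b = "rademacher_node \<alpha> k (Suc i)"
  have ab: "?a \<le> ?b"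
    using Suc.IH[OF i] .
  have \<alpha>': "0 \<le> \<alpha> (Suc k)" "\<alpha> (Suc k) \<le> 1"
    using \<alpha>[of "Suc k"] by auto
  show ?case
  proof (cases "even j")
    case True
    then have "j = 2 * i"
      by (simp add: i_def)
    then show ?thesis
      using ab \<alpha>' i by (simp only: rademacher_node_even rademacher_node_odd less_imp_le) simp
  next
    case False
    then have j: "j = Suc (2 * i)"
      by (simp add: i_def)
    have "rademacher_node \<alpha> (Suc k) (Suc j) = ?b"
      using rademacher_node_even[of "Suc i" k \<alpha>] i j by simp
    moreover have "\<alpha> (Suc k) * (?b - ?a) \<le> 1 * (?b - ?a)"
      using ab \<alpha>' by (intro mult_right_mono) auto
    ultimately show ?thesis
      unfolding j rademacher_node_odd by simp
  qed
qed

lemma rademacher_node_mono: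
  assumes \<alpha>: "\<And>k. k \<ge> 1 \<Longrightarrow> 0 \<le> \<alpha> k \<and> \<alpha> k \<le> 1"
    and "i \<le> j" "j \<le> 2 ^ k"
  shows "rademacher_node \<alpha> k i \<le> rademacher_node \<alpha> k j"
  using assms(2,3)
proof (induction rule: dec_induct)
  case (step n)
  then show ?case
    using rademacher_node_le_Suc[of \<alpha> n k, OF \<alpha>] by force
qed simp

text \<open>The constant ratio 1/2 inserts midpoints, which yields the dyadic grid of the classical
  functions.\<close>

lemma rademacher_node_half:
  "j \<le> 2 ^ k \<Longrightarrow> rademacher_node (\<lambda>_. 1 / 2) k j = real j / 2 ^ k"
proof (induction k arbitrary: j)
  case 0
  then show ?case by (cases j) auto
next
  case (Suc k)
  define i where "i = j div 2"
  show ?case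
  proof (cases "even j")
    case True
    then have j: "j = 2 * i"
      by (simp add: i_def)
    then have "i \<le> 2 ^ k"
      using Suc.prems by simp
    then show ?thesis
      unfolding j using Suc.IH[of i] by (simp only: rademacher_node_even) simp
  next
    case False
    then have j: "j = Suc (2 * i)"
      by (simp add: i_def)
    then have "i < 2 ^ k"
      using Suc.prems by simp
    then show ?thesis
      unfolding j rademacher_node_odd using Suc.IH[of i] Suc.IH[of "Suc i"]
      by (simp add: field_simps)
  qed
qed

section \<open>Rademacher functions\<close>

lemma rademacher_eq_gen_rademacher: "rademacher k = gen_rademacher (\<lambda>_. 1 / 2) k"
proof
  fix x
  have node: "rademacher_node (\<lambda>_. 1 / 2) k j = real j / 2 ^ k"
    "rademacher_node (\<lambda>_. 1 / 2) k (j + 1) = real (j + 1) / 2 ^ k"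
    if "j \<in> {0..2 ^ k - 1}" for j
  proof -
    have "j + 1 \<le> 2 ^ k"
      using that by (simp add: Suc_le_eq le_diff_conv2)
    then show "rademacher_node (\<lambda>_. 1 / 2) k j = real j / 2 ^ k"
      "rademacher_node (\<lambda>_. 1 / 2) k (j + 1) = real (j + 1) / 2 ^ k"
      by (simp_all only: rademacher_node_half add_leD1)
  qed
  show "rademacher k x = gen_rademacher (\<lambda>_. 1 / 2) k x"
    unfolding rademacher_def gen_rademacher_def by (simp only: node cong: sum.cong)
qed

lemma borel_measurable_gen_rademacher [measurable]: "gen_rademacher \<alpha> k \<in> borel_measurable borel"
  unfolding gen_rademacher_def by measurable

text \<open>Monotone division points make the cells of one level disjoint, so a single summand
  survives.\<close>

lemma gen_rademacher_eq:
  assumes \<alpha>: "\<And>k. k \<ge> 1 \<Longrightarrow> 0 \<le> \<alpha> k \<and> \<alpha> k \<le> 1"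
    and "k \<noteq> 0" "j < 2 ^ k"
    and x: "x \<in> {rademacher_node \<alpha> k j<..rademacher_node \<alpha> k (Suc j)}"
  shows "gen_rademacher \<alpha> k x = (-1) ^ j"
proof -
  let ?I = "\<lambda>i. {rademacher_node \<alpha> k i<..rademacher_node \<alpha> k (i + 1)}"
  have "x \<notin> ?I i" if "i < 2 ^ k" "i \<noteq> j" for i
  proof (cases "i < j")
    case True
    then have "rademacher_node \<alpha> k (i + 1) \<le> rademacher_node \<alpha> k j"
      using \<open>j < 2 ^ k\<close> by (intro rademacher_node_mono \<alpha>) auto
    then show ?thesis
      using x by auto
  next
    case False
    then have "rademacher_node \<alpha> k (Suc j) \<le> rademacher_node \<alpha> k i"
      using that by (intro rademacher_node_mono \<alpha>) auto
    then show ?thesis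
      using x by auto
  qed
  then have "indicator (?I i) x = (if i = j then 1 else 0 :: real)" if "i < 2 ^ k" for i
    using that x by (auto simp: indicator_def)
  moreover have "{0..2 ^ k - 1} = {..<2 ^ k :: nat}"
    by (auto simp: Suc_le_eq[symmetric] le_diff_conv2)
  ultimately have "gen_rademacher \<alpha> k x = (\<Sum>i<2 ^ k. (-1) ^ i * (if i = j then 1 else 0))"
    using \<open>k \<noteq> 0\<close> unfolding gen_rademacher_def by (auto intro!: sum.cong)
  also have "\<dots> = (-1) ^ j"
    using \<open>j < 2 ^ k\<close> by (simp add: if_distrib cong: if_cong)
  finally show ?thesis .
qed

section \<open>Independence\<close>

text \<open>A criterion that asks for the product formula on initial segments only. That
  \<open>w k\<close> is the law of \<open>X k\<close> is not presupposed; it follows from the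
  formula and \<open>w k UNIV = 1\<close>.\<close>

lemma (in prob_space) indep_vars_natI:
  fixes X :: "nat \<Rightarrow> 'a \<Rightarrow> 'b :: topological_space"
  assumes X [measurable]: "\<And>k. X k \<in> borel_measurable M"
    and prod: "\<And>B m. (\<And>k. B k \<in> sets borel) \<Longrightarrow>
      prob {x \<in> space M. \<forall>k\<le>m. X k x \<in> B k} = (\<Prod>k\<le>m. w k (B k))"
    and w: "\<And>k. w k UNIV = 1"
  shows "indep_vars (\<lambda>_. borel) X UNIV"
proof -
  have fin: "prob {x \<in> space M. \<forall>k\<in>J. X k x \<in> B k} = (\<Prod>k\<in>J. w k (B k))"
    if "finite J" "\<And>k. k \<in> J \<Longrightarrow> B k \<in> sets borel" for J B
  proof -
    obtain m where m: "J \<subseteq> {..m}"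
      using \<open>finite J\<close> by (metis finite_nat_iff_bounded_le)
    \<comment> \<open>Padding with \<open>UNIV\<close> extends \<open>J\<close> to an initial
      segment: the event stays the same and the new factors are 1.\<close>
    define B' where "B' k = (if k \<in> J then B k else UNIV)" for k
    have "prob {x \<in> space M. \<forall>k\<in>J. X k x \<in> B k} = prob {x \<in> space M. \<forall>k\<le>m. X k x \<in> B' k}"
      using m by (intro arg_cong[where f = prob]) (auto simp: B'_def)
    also have "\<dots> = (\<Prod>k\<le>m. w k (B' k))"
      using that by (intro prod) (auto simp: B'_def)
    also have "\<dots> = (\<Prod>k\<in>J. w k (B k))"
      using m by (intro prod.mono_neutral_cong_right) (auto simp: B'_def w)
    finally show ?thesis .
  qed
  have "indep_sets (\<lambda>k. {X k -` A \<inter> space M | A. A \<in> sets borel}) UNIV"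
  proof (rule indep_setsI)
    fix A J
    assume J: "J \<noteq> {}" "finite J"
      and "\<forall>j\<in>J. A j \<in> {X j -` A \<inter> space M | A. A \<in> sets borel}"
    then obtain B where B: "\<And>j. j \<in> J \<Longrightarrow> A j = X j -` B j \<inter> space M \<and> B j \<in> sets borel"
      by (simp only: mem_Collect_eq) metis
    have "prob (\<Inter>j\<in>J. A j) = prob {x \<in> space M. \<forall>k\<in>J. X k x \<in> B k}"
      using J B by (intro arg_cong[where f = prob]) auto
    also have "\<dots> = (\<Prod>k\<in>J. w k (B k))"
      using J B by (intro fin) auto
    also have "\<dots> = (\<Prod>k\<in>J. prob (A k))"
    proof (intro prod.cong refl)
      fix k
      assume "k \<in> J"
      \<comment> \<open>The one-element index set identifies \<open>w k (B k)\<close> as a marginal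
        probability.\<close>
      then have "A k = {x \<in> space M. \<forall>k\<in>{k}. X k x \<in> B k}"
        using B by auto
      then show "w k (B k) = prob (A k)"
        using fin[of "{k}" B] B \<open>k \<in> J\<close> by simp
    qed
    finally show "prob (\<Inter>j\<in>J. A j) = (\<Prod>k\<in>J. prob (A k))" .
  qed (auto intro: measurable_sets)
  then show ?thesis
    unfolding indep_vars_def2 by auto
qed

text \<open>The induction on \<open>m\<close> treats all cells of all levels at once, since it
  passes to the children of a cell. The inserted point cuts a cell of level \<open>n\<close> into
  two cells with length shares \<open>\<alpha> (Suc n)\<close> and
  \<open>1 - \<alpha> (Suc n)\<close>, on which the function of level \<open>Suc n\<close> is 1 and
  -1. Both children carry the same product for the later levels, so it factors out.\<close>

lemma (in prob_space) prob_gen_rademacher_cell: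
  fixes U :: "'a \<Rightarrow> real"
  assumes U [measurable]: "U \<in> borel_measurable M"
    and unif: "\<And>u v. 0 \<le> u \<Longrightarrow> u \<le> v \<Longrightarrow> v \<le> 1 \<Longrightarrow> prob {x \<in> space M. U x \<in> {u<..v}} = v - u"
    and \<alpha>: "\<And>k. k \<ge> 1 \<Longrightarrow> 0 \<le> \<alpha> k \<and> \<alpha> k \<le> 1"
    and B [measurable]: "\<And>k. B k \<in> sets borel"
  shows "j < 2 ^ n \<Longrightarrow>
    prob {x \<in> space M. U x \<in> {rademacher_node \<alpha> n j<..rademacher_node \<alpha> n (Suc j)} \<and>
        (\<forall>k\<in>{n<..n + m}. gen_rademacher \<alpha> k (U x) \<in> B k)}
    = (rademacher_node \<alpha> n (Suc j) - rademacher_node \<alpha> n j)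
      * (\<Prod>k\<in>{n<..n + m}. \<alpha> k * indicator (B k) 1 + (1 - \<alpha> k) * indicator (B k) (-1))"
proof (induction m arbitrary: n j)
  case 0
  \<comment> \<open>With an empty product only \<open>unif\<close> is left, which asks for ordered
    end points in \<open>[0,1]\<close>.\<close>
  have "0 \<le> rademacher_node \<alpha> n j" "rademacher_node \<alpha> n j \<le> rademacher_node \<alpha> n (Suc j)"
    "rademacher_node \<alpha> n (Suc j) \<le> 1"
    using 0 rademacher_node_mono[of \<alpha> 0 j n, OF \<alpha>] rademacher_node_mono[of \<alpha> j "Suc j" n, OF \<alpha>]
      rademacher_node_mono[of \<alpha> "Suc j" "2 ^ n" n, OF \<alpha>]
    by (auto simp: rademacher_node_0 rademacher_node_top)
  then show ?case
    using unif by simp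
next
  case (Suc m)
  let ?a = "rademacher_node \<alpha> n j" and ?b = "rademacher_node \<alpha> n (Suc j)"
  let ?c = "rademacher_node \<alpha> (Suc n) (Suc (2 * j))"
  let ?w = "\<lambda>k. \<alpha> k * indicator (B k) 1 + (1 - \<alpha> k) * indicator (B k) (-1) :: real"
  define E where
    "E I = {x \<in> space M. U x \<in> I \<and> (\<forall>k\<in>{Suc n<..Suc n + m}. gen_rademacher \<alpha> k (U x) \<in> B k)}"
    for I
  have E [measurable]: "E I \<in> events" if "I \<in> sets borel" for I
    using that unfolding E_def by measurable
  have split: "{n<..n + Suc m} = insert (Suc n) {Suc n<..Suc n + m}"
    by auto
  have even: "rademacher_node \<alpha> (Suc n) (2 * j) = ?a"
      "rademacher_node \<alpha> (Suc n) (Suc (Suc (2 * j))) = ?b"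
    using Suc.prems rademacher_node_even[of j n \<alpha>] rademacher_node_even[of "Suc j" n \<alpha>]
    by simp_all
  have c: "?c - ?a = \<alpha> (Suc n) * (?b - ?a)" "?b - ?c = (1 - \<alpha> (Suc n)) * (?b - ?a)"
    unfolding rademacher_node_odd by (simp_all add: algebra_simps)
  have lt: "2 * j < 2 ^ Suc n" "Suc (2 * j) < 2 ^ Suc n"
    using Suc.prems by auto
  have le: "?a \<le> ?c" "?c \<le> ?b"
    using rademacher_node_le_Suc[of \<alpha>, OF \<alpha> lt(1)] rademacher_node_le_Suc[of \<alpha>, OF \<alpha> lt(2)]
    by (simp_all only: even)
  \<comment> \<open>The left child has the even index \<open>2 * j\<close>, the right child the odd
    index \<open>Suc (2 * j)\<close>; this gives the signs.\<close>
  have val: "gen_rademacher \<alpha> (Suc n) y = 1" if "y \<in> {?a<..?c}" for y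
    using gen_rademacher_eq[of \<alpha>, OF \<alpha> _ lt(1), of y] that even by simp
  have val': "gen_rademacher \<alpha> (Suc n) y = -1" if "y \<in> {?c<..?b}" for y
    using gen_rademacher_eq[of \<alpha>, OF \<alpha> _ lt(2), of y] that even by simp
  have PE: "prob (E {?a<..?c}) = (?c - ?a) * (\<Prod>k\<in>{Suc n<..Suc n + m}. ?w k)"
    using Suc.IH[OF lt(1)] unfolding E_def even .
  have PE': "prob (E {?c<..?b}) = (?b - ?c) * (\<Prod>k\<in>{Suc n<..Suc n + m}. ?w k)"
    using Suc.IH[OF lt(2)] unfolding E_def even .
  \<comment> \<open>The function of level \<open>Suc n\<close> is constant on a child, so its
    constraint keeps the whole event of that child or nothing.\<close>
  let ?L = "if 1 \<in> B (Suc n) then E {?a<..?c} else {}"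
  let ?R = "if -1 \<in> B (Suc n) then E {?c<..?b} else {}"
  have "{x \<in> space M. U x \<in> {?a<..?b} \<and> (\<forall>k\<in>{n<..n + Suc m}. gen_rademacher \<alpha> k (U x) \<in> B k)}
    = ?L \<union> ?R" (is "?S = _")
  proof (intro set_eqI)
    fix x
    consider "U x \<in> {?a<..?c}" "U x \<notin> {?c<..?b}" "U x \<in> {?a<..?b}"
      | "U x \<in> {?c<..?b}" "U x \<notin> {?a<..?c}" "U x \<in> {?a<..?b}"
      | "U x \<notin> {?a<..?c}" "U x \<notin> {?c<..?b}" "U x \<notin> {?a<..?b}"
      using le by fastforce
    then show "x \<in> ?S \<longleftrightarrow> x \<in> ?L \<union> ?R"
      unfolding split E_def
      by cases (auto simp: val val')
  qed
  also have "prob (?L \<union> ?R) = prob ?L + prob ?R"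
    by (intro finite_measure_Union) (auto simp: E_def)
  also have "\<dots> = indicator (B (Suc n)) 1 * prob (E {?a<..?c})
      + indicator (B (Suc n)) (-1) * prob (E {?c<..?b})"
    by (simp add: indicator_def)
  also have "\<dots> = (?b - ?a) * (?w (Suc n) * (\<Prod>k\<in>{Suc n<..Suc n + m}. ?w k))"
    unfolding PE PE' c by (simp add: algebra_simps)
  also have "\<dots> = (?b - ?a) * (\<Prod>k\<in>{n<..n + Suc m}. ?w k)"
    unfolding split by (subst prod.insert) auto
  finally show ?case .
qed

text \<open>\<open>{0<..1}\<close> is the only cell of level 0, so the cell formula with
  \<open>n = 0\<close> gives the joint law of the indices from 1 to \<open>m\<close>; index 0 adds a
  constant.\<close>

lemma (in prob_space) indep_vars_gen_rademacher:
  fixes U :: "'a \<Rightarrow> real"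
  assumes U [measurable]: "U \<in> borel_measurable M"
    and unif: "\<And>u v. 0 \<le> u \<Longrightarrow> u \<le> v \<Longrightarrow> v \<le> 1 \<Longrightarrow> prob {x \<in> space M. U x \<in> {u<..v}} = v - u"
    and \<alpha>: "\<And>k. k \<ge> 1 \<Longrightarrow> 0 \<le> \<alpha> k \<and> \<alpha> k \<le> 1"
  shows "indep_vars (\<lambda>_. borel) (\<lambda>k. gen_rademacher \<alpha> k \<circ> U) UNIV"
proof -
  \<comment> \<open>The value 1 at index 0 makes \<open>w 0\<close> the point mass at 1, the law of
    the constant function.\<close>
  define \<beta> where "\<beta> k = (if k = 0 then 1 else \<alpha> k)" for k
  define w where "w k B = \<beta> k * indicator B 1 + (1 - \<beta> k) * indicator B (-1 :: real)" for k B
  \<comment> \<open>The cell of level 0 is open at 0; the values of \<open>U\<close> outside it, 0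
    included, form a null event.\<close>
  have AE: "AE x in M. U x \<in> {0<..1}"
    using unif[of 0 1] by (subst prob_Collect_eq_1[symmetric]) auto
  show ?thesis
  proof (rule indep_vars_natI[where w = w])
    fix B :: "nat \<Rightarrow> real set" and m
    assume B: "\<And>k. B k \<in> sets borel"
    note [measurable] = B
    have "prob {x \<in> space M. \<forall>k\<le>m. (gen_rademacher \<alpha> k \<circ> U) x \<in> B k}
      = prob {x \<in> space M. 1 \<in> B 0 \<and> U x \<in> {0<..1} \<and>
          (\<forall>k\<in>{0<..m}. gen_rademacher \<alpha> k (U x) \<in> B k)}"
    proof (rule finite_measure_eq_AE)
      show "AE x in M. x \<in> {x \<in> space M. \<forall>k\<le>m. (gen_rademacher \<alpha> k \<circ> U) x \<in> B k} \<longleftrightarrow>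
        x \<in> {x \<in> space M. 1 \<in> B 0 \<and> U x \<in> {0<..1} \<and>
          (\<forall>k\<in>{0<..m}. gen_rademacher \<alpha> k (U x) \<in> B k)}"
        using AE
      proof eventually_elim
        case (elim x)
        have "(\<forall>k\<le>m. gen_rademacher \<alpha> k (U x) \<in> B k) \<longleftrightarrow>
          gen_rademacher \<alpha> 0 (U x) \<in> B 0 \<and> (\<forall>k\<in>{0<..m}. gen_rademacher \<alpha> k (U x) \<in> B k)"
          by (metis bot_nat_0.not_eq_extremum greaterThanAtMost_iff zero_le)
        then show ?case
          using elim by (simp add: gen_rademacher_def[where k = 0])
      qed
    qed measurable
    also have "\<dots> = indicator (B 0) 1 * prob {x \<in> space M. U x \<in> {0<..1} \<and>
          (\<forall>k\<in>{0<..m}. gen_rademacher \<alpha> k (U x) \<in> B k)}"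
      by (simp add: indicator_def)
    also have "\<dots> = indicator (B 0) 1 * (\<Prod>k\<in>{0<..m}. w k (B k))"
      using prob_gen_rademacher_cell[OF U unif \<alpha> B, where n = 0 and j = 0 and m = m]
      by (simp add: w_def \<beta>_def)
    also have "\<dots> = (\<Prod>k\<in>insert 0 {0<..m}. w k (B k))"
      by (subst prod.insert) (auto simp: w_def \<beta>_def)
    also have "insert 0 {0<..m} = {..m}"
      by auto
    finally show "prob {x \<in> space M. \<forall>k\<le>m. (gen_rademacher \<alpha> k \<circ> U) x \<in> B k}
      = (\<Prod>k\<le>m. w k (B k))" .
  qed (auto simp: w_def comp_def)
qed

section \<open>The distribution function of a diffuse measure\<close>

context real_distribution
begin

text \<open>The jump of \<open>cdf M\<close> at \<open>x\<close> is the mass of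
  \<open>{x}\<close>.\<close>

lemma isCont_cdf_diffuse: "diffuse M \<Longrightarrow> isCont (cdf M) x"
  by (simp add: isCont_cdf diffuse_def measure_def)

lemma cdf_surj_diffuse:
  assumes "diffuse M" "0 < u" "u < 1"
  obtains x where "cdf M x = u"
proof -
  have "\<forall>\<^sub>F x in at_bot. cdf M x < u"
    using order_tendstoD(2)[OF cdf_lim_at_bot \<open>0 < u\<close>] .
  then obtain a where a: "\<And>x. x \<le> a \<Longrightarrow> cdf M x < u"
    by (auto simp: eventually_at_bot_linorder)
  have "\<forall>\<^sub>F x in at_top. u < cdf M x"
    using order_tendstoD(1)[OF cdf_lim_at_top_prob \<open>u < 1\<close>] .
  then obtain b where b: "\<And>x. x \<ge> b \<Longrightarrow> u < cdf M x"
    by (auto simp: eventually_at_top_linorder)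
  \<comment> \<open>The points \<open>a\<close> and \<open>b\<close> come from the two tails;
    \<open>max a b\<close> keeps the interval nonempty in case \<open>b < a\<close>.\<close>
  have "\<exists>x\<ge>a. x \<le> max a b \<and> cdf M x = u"
    using a[of a] b[of "max a b"] isCont_cdf_diffuse[OF \<open>diffuse M\<close>]
    by (intro IVT) auto
  then show ?thesis
    using that by auto
qed

lemma borel_measurable_cdf [measurable]: "cdf M \<in> borel_measurable borel"
  by (rule borel_measurable_mono) (auto intro: monoI cdf_nondecreasing)

text \<open>The probability integral transform. Since \<open>cdf M\<close> may have flat pieces, the
  sublevel set can reach beyond a given point of value \<open>u\<close>. Such a point bounds the
  mass from below, and points of values \<open>v > u\<close> bound it from above.\<close>

lemma prob_cdf_le:
  assumes "diffuse M" "0 \<le> u" "u \<le> 1"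
  shows "prob {x. cdf M x \<le> u} = u"
proof (rule antisym)
  have meas: "{x. cdf M x \<le> v} \<in> events" for v
    by measurable
  show "prob {x. cdf M x \<le> u} \<le> u"
  proof (cases "u = 1")
    case False
    show ?thesis
    proof (rule dense_ge_bounded)
      show "u < 1"
        using False \<open>u \<le> 1\<close> by simp
    next
      fix v
      assume "u < v" "v < 1"
      then obtain x where x: "cdf M x = v"
        using cdf_surj_diffuse[of v] assms by auto
      \<comment> \<open>The sublevel set lies in \<open>{..x}\<close>, whose mass is
        \<open>v\<close>; then \<open>v\<close> decreases to \<open>u\<close>.\<close>
      have "y \<le> x" if "cdf M y \<le> u" for y
        using that \<open>u < v\<close> x cdf_nondecreasing by (metis le_cases not_le order_trans)
      then show "prob {y. cdf M y \<le> u} \<le> v"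
        unfolding x[symmetric] cdf_def by (intro finite_measure_mono) auto
    qed
  qed simp
  show "u \<le> prob {x. cdf M x \<le> u}"
  proof -
    \<comment> \<open>Surjectivity covers the open interval only. At 0 the bound is nonnegativity,
      at 1 the sublevel set is the whole space.\<close>
    consider "u = 0" | "u = 1" | "0 < u" "u < 1"
      using assms by fastforce
    then show ?thesis
    proof cases
      case 2
      then have "{x. cdf M x \<le> u} = space M"
        using cdf_bounded_prob by auto
      then show ?thesis
        using 2 prob_space by simp
    next
      case 3
      then obtain x where x: "cdf M x = u"
        using cdf_surj_diffuse[of u] assms by auto
      have "{..x} \<subseteq> {y. cdf M y \<le> u}"
        unfolding x[symmetric] using cdf_nondecreasing by auto
      then have "cdf M x \<le> prob {y. cdf M y \<le> u}"
        unfolding cdf_def2[of M x] by (intro finite_measure_mono meas)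
      then show ?thesis
        by (simp add: x)
    qed simp
  qed
qed

lemma prob_cdf_greaterThanAtMost:
  assumes "diffuse M" "0 \<le> u" "u \<le> v" "v \<le> 1"
  shows "prob {x \<in> space M. cdf M x \<in> {u<..v}} = v - u"
proof -
  have "{x \<in> space M. cdf M x \<in> {u<..v}} = {x. cdf M x \<le> v} - {x. cdf M x \<le> u}"
    by auto
  also have "prob \<dots> = prob {x. cdf M x \<le> v} - prob {x. cdf M x \<le> u}"
    using \<open>u \<le> v\<close> by (intro finite_measure_Diff) (measurable, auto)
  also have "\<dots> = v - u"
    using assms by (simp add: prob_cdf_le)
  finally show ?thesis .
qed

end

section \<open>Independence of both sequences composed with the distribution function\<close>

theorem proposition1p3p2:
  fixes \<mu> :: "real measure" and \<alpha> :: "nat \<Rightarrow> real"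
  assumes "real_distribution \<mu>"
    and "diffuse \<mu>"
    and "\<And>k. k \<ge> 1 \<Longrightarrow> 0 < \<alpha> k \<and> \<alpha> k < 1"
  shows "prob_space.indep_vars \<mu> (\<lambda>_. borel) (\<lambda>k. gen_rademacher \<alpha> k \<circ> cdf \<mu>) UNIV
       \<and> prob_space.indep_vars \<mu> (\<lambda>_. borel) (\<lambda>k. rademacher k \<circ> cdf \<mu>) UNIV"
proof -
  interpret real_distribution \<mu> by fact
  \<comment> \<open>Arbitrary ratios in \<open>[0,1]\<close> cover both \<open>\<alpha>\<close> and
    the constant 1/2.\<close>
  have "indep_vars (\<lambda>_. borel) (\<lambda>k. gen_rademacher \<beta> k \<circ> cdf \<mu>) UNIV"
    if "\<And>k. k \<ge> 1 \<Longrightarrow> 0 \<le> \<beta> k \<and> \<beta> k \<le> 1" for \<beta>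
    using that prob_cdf_greaterThanAtMost[OF \<open>diffuse \<mu>\<close>]
    by (intro indep_vars_gen_rademacher) auto
  then show ?thesis
    unfolding rademacher_eq_gen_rademacher using assms(3) by (simp add: less_imp_le)
qed

end
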